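(* For integers $n$ and $k\ge 1$, let $B(n;k)$ denote the number of sequences $(a_k,a_{k-1},\dots,a_1)\in\{-1,0,1\}^k$ such that $\sum_{i=1}^k a_iF_i=n$, where $F_i$ is the $i$-th Fibonacci number ($F_1=F_2=1$, $F_i=F_{i-1}+F_{i-2}$ for $i\ge 3$). Then \[ B(0;k+1)=B(0;k)+B(0;k-1)+B(0;k-2)\qquad\text{for all } k\ge 3, \] with $B(0;1)=1$, $B(0;2)=3$, and $B(0;3)=5$.
   Context: A representation of length $k$ is a sequence of digits $(a_k,\dots,a_1)$ with each $a_i\in\{1,0,-1\}$, representing the integer $\sum_{i=1}^k a_iF_i$; the length is $k$ even if $a_k=0$. Note that $F_1$ and $F_2$ are treated as distinct positions, so both may be used. *)

theory Defs
  imports "HOL-Number_Theory.Fib" "HOL-Library.FuncSet"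
begin

text \<open>
  A representation of length \<open>k\<close> is a digit sequence \<open>(a\<^sub>k, \<dots>, a\<^sub>1)\<close>. It is encoded as a function on
  the positions \<open>{1..k}\<close>; extensionality (\<open>\<rightarrow>\<^sub>E\<close>) makes the functions correspond one-to-one to the
  sequences, so leading zeros are allowed and the positions 1 and 2 are distinct although
  \<open>fib 1 = fib 2\<close>.
\<close>

definition fib_reps :: "int \<Rightarrow> nat \<Rightarrow> (nat \<Rightarrow> int) set" where
  "fib_reps n k = {a \<in> {1..k} \<rightarrow>\<^sub>E {-1, 0, 1}. (\<Sum>i=1..k. a i * int (fib i)) = n}"

definition B :: "int \<Rightarrow> nat \<Rightarrow> nat" where
  "B n k = card (fib_reps n k)"

end

theory Submission
  imports Defs
begin

text \<open>
  Splitting off the leading digit gives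
  \<open>B n (k+1) = B n k + B (n - F\<^sub>k\<^sub>+\<^sub>1) k + B (n + F\<^sub>k\<^sub>+\<^sub>1) k\<close>, and \<open>B n k = 0\<close> as soon as
  \<open>\<bar>n\<bar> \<ge> F\<^sub>k\<^sub>+\<^sub>2\<close>, since \<open>F\<^sub>1 + \<dots> + F\<^sub>k = F\<^sub>k\<^sub>+\<^sub>2 - 1\<close>. With \<open>b\<^sub>k = B 0 k\<close> and \<open>d\<^sub>k = B F\<^sub>k k\<close> these
  facts leave only \<open>b\<^sub>k\<^sub>+\<^sub>2 = b\<^sub>k\<^sub>+\<^sub>1 + 2 d\<^sub>k\<close> and \<open>d\<^sub>k\<^sub>+\<^sub>2 = d\<^sub>k + b\<^sub>k\<^sub>+\<^sub>1\<close>; eliminating \<open>d\<close> yields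
  the three-term recurrence.
\<close>

lemma finite_fib_reps: "finite (fib_reps n k)"
  unfolding fib_reps_def by (intro finite_subset[OF Collect_restrict] finite_PiE) auto

lemma fib_reps_Suc:
  "fib_reps n (Suc k) =
    (\<Union>d\<in>{-1, 0, 1}. (\<lambda>a. a(Suc k := d)) ` fib_reps (n - d * int (fib (Suc k))) k)"
proof -
  have sum_upd: "(\<Sum>i=1..Suc k. (a(Suc k := d)) i * int (fib i)) =
      (\<Sum>i=1..k. a i * int (fib i)) + d * int (fib (Suc k))" for a :: "nat \<Rightarrow> int" and d
    by (simp del: fib.simps)
  have "{1..Suc k} = insert (Suc k) {1..k}"
    by auto
  then have "{1..Suc k} \<rightarrow>\<^sub>E {-1, 0, 1 :: int} =
      (\<lambda>(d, a). a(Suc k := d)) ` ({-1, 0, 1} \<times> ({1..k} \<rightarrow>\<^sub>E {-1, 0, 1}))"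
    by (simp only: PiE_insert_eq)
  then have "fib_reps n (Suc k) =
      {a \<in> (\<Union>d\<in>{-1, 0, 1}. (\<lambda>a. a(Suc k := d)) ` ({1..k} \<rightarrow>\<^sub>E {-1, 0, 1})).
        (\<Sum>i=1..Suc k. a i * int (fib i)) = n}"
    unfolding fib_reps_def by auto
  also have "\<dots> = (\<Union>d\<in>{-1, 0, 1}. (\<lambda>a. a(Suc k := d)) `
      {a \<in> {1..k} \<rightarrow>\<^sub>E {-1, 0, 1}. (\<Sum>i=1..Suc k. (a(Suc k := d)) i * int (fib i)) = n})"
    by blast
  finally show ?thesis
    unfolding sum_upd fib_reps_def by (simp only: eq_diff_eq)
qed

text \<open>Overwriting position \<open>Suc k\<close> loses nothing: extensionality fixes the value
  there to \<open>undefined\<close>.\<close>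

lemma card_image_fib_reps:
  "card ((\<lambda>a. a(Suc k := d)) ` fib_reps n k) = B n k"
  unfolding B_def
proof (rule card_image, rule inj_onI)
  fix a b assume "a \<in> fib_reps n k" "b \<in> fib_reps n k" "a(Suc k := d) = b(Suc k := d)"
  then have "a (Suc k) = undefined" "b (Suc k) = undefined" "\<And>i. i \<noteq> Suc k \<Longrightarrow> a i = b i"
    by (auto simp: fib_reps_def PiE_def extensional_def fun_eq_iff split: if_splits)
  then show "a = b"
    by (metis ext)
qed

lemma B_Suc:
  "B n (Suc k) = B n k + B (n - int (fib (Suc k))) k + B (n + int (fib (Suc k))) k"
proof -
  have "B n (Suc k) =
      (\<Sum>d\<in>{-1, 0, 1}. card ((\<lambda>a. a(Suc k := d)) ` fib_reps (n - d * int (fib (Suc k))) k))"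
    unfolding B_def fib_reps_Suc
  proof (rule card_UN_disjoint)
    show "\<forall>d\<in>{-1, 0, 1}. \<forall>e\<in>{-1, 0, 1}. d \<noteq> e \<longrightarrow>
        (\<lambda>a. a(Suc k := d)) ` fib_reps (n - d * int (fib (Suc k))) k \<inter>
        (\<lambda>a. a(Suc k := e)) ` fib_reps (n - e * int (fib (Suc k))) k = {}"
      by (auto dest!: fun_cong[of _ _ "Suc k"])
  qed (auto simp: finite_fib_reps)
  then show ?thesis
    unfolding card_image_fib_reps by (simp del: fib.simps)
qed

lemma B_0: "B n 0 = (if n = 0 then 1 else 0)"
  by (simp add: B_def fib_reps_def)

lemma B_uminus: "B (- n) k = B n k"
proof (induction k arbitrary: n)
  case (Suc k)
  have "B (- n - int (fib (Suc k))) k = B (n + int (fib (Suc k))) k"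
    using Suc.IH[of "n + int (fib (Suc k))"] by simp
  moreover have "B (- n + int (fib (Suc k))) k = B (n - int (fib (Suc k))) k"
    using Suc.IH[of "n - int (fib (Suc k))"] by (simp add: algebra_simps)
  ultimately show ?case
    by (simp add: B_Suc Suc.IH del: fib.simps)
qed (simp add: B_0)

lemma B_eq_0:
  assumes "int (fib (k + 2)) \<le> n"
  shows "B n k = 0"
  using assms
proof (induction k arbitrary: n)
  case (Suc k)
  \<comment> \<open>Since F(k+3) - F(k+1) = F(k+2), all three shifted targets stay out of range for
    length \<open>k\<close>.\<close>
  then show ?case
    by (simp add: B_Suc)
qed (simp add: B_0)

text \<open>The leading digit must be 1: digits 0 and -1 leave a remainder too large for length
  \<open>k\<close>.\<close>

lemma B_fib_Suc: "B (int (fib (k + 2))) (k + 1) = B (int (fib k)) k"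
  using B_eq_0[of k "int (fib (k + 2))"] B_eq_0[of k "int (fib (k + 2) + fib (k + 1))"]
  by (simp add: B_Suc)

lemma B_zero_rec: "B 0 (k + 2) = B 0 (k + 1) + 2 * B (int (fib k)) k"
  using B_fib_Suc[of k] B_uminus[of "int (fib (k + 2))" "k + 1"]
    B_Suc[of 0 "k + 1"]
  by (simp del: fib.simps)

lemma B_fib_rec: "B (int (fib (k + 2))) (k + 2) = B (int (fib k)) k + B 0 (k + 1)"
proof -
  \<comment> \<open>This rules out the leading digit -1, which would leave 2 F(k+2).\<close>
  have "fib (k + 3) \<le> 2 * fib (k + 2)"
    by (simp add: numeral_eq_Suc)
  then have "B (2 * int (fib (k + 2))) (k + 1) = 0"
    by (intro B_eq_0) (simp add: numeral_eq_Suc)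
  then show ?thesis
    using B_fib_Suc[of k] B_Suc[of "int (fib (k + 2))" "k + 1"] by (simp del: fib.simps)
qed

theorem theorem1p1:
  shows "(\<forall>k\<ge>3. B 0 (k + 1) = B 0 k + B 0 (k - 1) + B 0 (k - 2))
    \<and> B 0 1 = 1 \<and> B 0 2 = 3 \<and> B 0 3 = 5"
proof (intro conjI allI impI)
  fix k :: nat assume "3 \<le> k"
  then obtain m where "k = m + 3"
    by (metis add.commute le_Suc_ex)
  \<comment> \<open>With k = m + 3, the unknown d(m) is eliminated through 2 d(m) = b(m+2) -
    b(m+1).\<close>
  then show "B 0 (k + 1) = B 0 k + B 0 (k - 1) + B 0 (k - 2)"
    using B_zero_rec[of m] B_zero_rec[of "m + 2"] B_fib_rec[of m]
    by (simp add: numeral_eq_Suc del: fib.simps)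
qed (simp_all add: numeral_eq_Suc B_Suc B_0)

end
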